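(* Consider the planar system $\dot v=\mu v-\omega w+f(v,w)$, $\dot w=\omega v+\mu w+g(v,w)$, $\omega\ne0$, with $$f=a_{11}v|v|+a_{12}v|w|+a_{21}w|v|+a_{22}w|w|,\qquad g=b_{11}v|v|+b_{12}v|w|+b_{21}w|v|+b_{22}w|w|.$$ For any such $f,g$ with a sign change in the coefficients $a_{11},a_{12},b_{21},b_{22}$, there are smooth approximations $f_\varepsilon,g_\varepsilon$ with $(f_\varepsilon,g_\varepsilon)\to(f,g)$ in $L^\infty$ (as $\varepsilon\to0$) such that the criticality of the Hopf bifurcation of the smoothed system (with $f,g$ replaced by $f_\varepsilon,g_\varepsilon$) at $\mu=0$ is opposite to that of the nonsmooth case. Moreover, $f_\varepsilon,g_\varepsilon$ can be chosen by replacing the absolute values in $f,g$ with symmetric smooth convex approximations of the absolute value.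
   Context: The criticality of the nonsmooth Hopf bifurcation at $\mu=0$ is determined by the sign of $\sigma_{\#}=2a_{11}+a_{12}+b_{21}+2b_{22}$: subcritical if $\sigma_{\#}>0$, supercritical if $\sigma_{\#}<0$. The criticality of the smooth Hopf bifurcation is determined by the sign of the classical first Lyapunov coefficient of the smoothed system: subcritical if positive, supercritical if negative. The approximations of $|\cdot|$ in the different terms of $f,g$ are allowed to be different. "Sign change" means that the four coefficients do not all have the same sign (at least one is positive and at least one negative). *)

theory Defs
  imports "HOL-Probability.Essential_Supremum"
begin

text \<open>Continuous differentiability of order \<open>k\<close> on the whole space, and \<open>C\<^sup>\<infinity>\<close>.\<close>

primrec Ck :: "nat \<Rightarrow> ('a::real_normed_vector \<Rightarrow> 'b::real_normed_vector) \<Rightarrow> bool" where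
  "Ck 0 f \<longleftrightarrow> continuous_on UNIV f"
| "Ck (Suc k) f \<longleftrightarrow>
     (\<forall>x. f differentiable (at x)) \<and> (\<forall>h. Ck k (\<lambda>x. frechet_derivative f (at x) h))"

definition smooth :: "('a::real_normed_vector \<Rightarrow> 'b::real_normed_vector) \<Rightarrow> bool" where
  "smooth f \<longleftrightarrow> (\<forall>k. Ck k f)"

definition Linf_norm :: "'a::euclidean_space set \<Rightarrow> ('a \<Rightarrow> 'b::real_normed_vector) \<Rightarrow> ennreal" where
  "Linf_norm S f = esssup (restrict_space lborel S) (\<lambda>x. ennreal (norm (f x)))"

text \<open>For a smooth \<open>s\<close>, \<open>w * (s v - \<bar>v\<bar>)\<close> is unbounded in \<open>w\<close>. Hence terms obtained
  by smoothing the absolute values converge in \<open>L\<^sup>\<infinity>\<close> only locally, that is, with \<open>S\<close>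
  ranging over the compact sets.\<close>

definition Linf_tendsto ::
  "'a::euclidean_space set \<Rightarrow> (real \<Rightarrow> 'a \<Rightarrow> 'b::real_normed_vector) \<Rightarrow> ('a \<Rightarrow> 'b) \<Rightarrow> bool" where
  "Linf_tendsto S F f \<longleftrightarrow> ((\<lambda>\<epsilon>. Linf_norm S (\<lambda>x. F \<epsilon> x - f x)) \<longlongrightarrow> 0) (at_right 0)"

text \<open>The nonlinear term with coefficients \<open>c\<^sub>i\<^sub>j\<close>, where the absolute value in the
  \<open>(i,j)\<close>-th summand is replaced by \<open>\<sigma> i j\<close>. The coefficient matrix has the numeral type \<open>2\<close>
  as index type, whose two distinct elements are \<open>1\<close> and \<open>2\<close>.\<close>

definition quad_term ::
  "(2 \<Rightarrow> 2 \<Rightarrow> real \<Rightarrow> real) \<Rightarrow> real^2^2 \<Rightarrow> real \<times> real \<Rightarrow> real" where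
  "quad_term \<sigma> c = (\<lambda>(v, w).
      c $ 1 $ 1 * v * \<sigma> 1 1 v + c $ 1 $ 2 * v * \<sigma> 1 2 w
    + c $ 2 $ 1 * w * \<sigma> 2 1 v + c $ 2 $ 2 * w * \<sigma> 2 2 w)"

abbreviation abs_term :: "real^2^2 \<Rightarrow> real \<times> real \<Rightarrow> real" where
  "abs_term \<equiv> quad_term (\<lambda>_ _. abs)"

definition planar_field ::
  "real \<Rightarrow> real \<Rightarrow> (real \<times> real \<Rightarrow> real) \<Rightarrow> (real \<times> real \<Rightarrow> real) \<Rightarrow> real \<times> real \<Rightarrow> real \<times> real" where
  "planar_field \<mu> \<omega> f g = (\<lambda>(v, w).
     (\<mu> * v - \<omega> * w + f (v, w), \<omega> * v + \<mu> * w + g (v, w)))"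

definition sign_change :: "real^2^2 \<Rightarrow> real^2^2 \<Rightarrow> bool" where
  "sign_change a b \<longleftrightarrow>
     (\<exists>x\<in>{a $ 1 $ 1, a $ 1 $ 2, b $ 2 $ 1, b $ 2 $ 2}. x > 0) \<and>
     (\<exists>x\<in>{a $ 1 $ 1, a $ 1 $ 2, b $ 2 $ 1, b $ 2 $ 2}. x < 0)"

text \<open>The criticality of the nonsmooth and of the smooth Hopf bifurcation is read off the sign of
  \<open>\<sigma>\<^sub>#\<close> and of the first Lyapunov coefficient, respectively.\<close>

definition sigma_sharp :: "real^2^2 \<Rightarrow> real^2^2 \<Rightarrow> real" where
  "sigma_sharp a b = 2 * a $ 1 $ 1 + a $ 1 $ 2 + b $ 2 $ 1 + 2 * b $ 2 $ 2"

definition nonsmooth_subcritical :: "real^2^2 \<Rightarrow> real^2^2 \<Rightarrow> bool" where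
  "nonsmooth_subcritical a b \<longleftrightarrow> sigma_sharp a b > 0"

definition nonsmooth_supercritical :: "real^2^2 \<Rightarrow> real^2^2 \<Rightarrow> bool" where
  "nonsmooth_supercritical a b \<longleftrightarrow> sigma_sharp a b < 0"

text \<open>A smooth system whose linearization at the equilibrium \<open>0\<close> is
  \<open>(v, w) \<mapsto> (\<mu> v - \<omega> w, \<omega> v + \<mu> w)\<close>: the eigenvalues \<open>\<mu> \<plusminus> i \<omega>\<close> cross the imaginary
  axis at \<open>\<mu> = 0\<close> with nonzero speed.\<close>

definition smooth_hopf ::
  "real \<Rightarrow> (real \<times> real \<Rightarrow> real) \<Rightarrow> (real \<times> real \<Rightarrow> real) \<Rightarrow> bool" where
  "smooth_hopf \<omega> f g \<longleftrightarrow> smooth f \<and> smooth g \<and> \<omega> \<noteq> 0 \<and>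
     (\<forall>\<mu>. planar_field \<mu> \<omega> f g (0, 0) = (0, 0) \<and>
        (planar_field \<mu> \<omega> f g has_derivative (\<lambda>(v, w). (\<mu> * v - \<omega> * w, \<omega> * v + \<mu> * w)))
          (at (0, 0)))"

definition Dv :: "(real \<times> real \<Rightarrow> real) \<Rightarrow> real \<times> real \<Rightarrow> real" where
  "Dv f = (\<lambda>(v, w). deriv (\<lambda>x. f (x, w)) v)"

definition Dw :: "(real \<times> real \<Rightarrow> real) \<Rightarrow> real \<times> real \<Rightarrow> real" where
  "Dw f = (\<lambda>(v, w). deriv (\<lambda>y. f (v, y)) w)"

text \<open>The Guckenheimer--Holmes formula for \<open>v' = - \<omega> w + f\<close>, \<open>w' = \<omega> v + g\<close>, where
  \<open>f\<close>, \<open>g\<close> vanish to second order at \<open>0\<close>. It is invariant under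
  \<open>(w, \<omega>) \<mapsto> (-w, -\<omega>)\<close> and hence valid for either sign of \<open>\<omega>\<close>; other common
  normalizations differ by a positive factor.\<close>

definition first_lyapunov ::
  "real \<Rightarrow> (real \<times> real \<Rightarrow> real) \<Rightarrow> (real \<times> real \<Rightarrow> real) \<Rightarrow> real" where
  "first_lyapunov \<omega> f g =
     (let f\<^sub>v\<^sub>v = Dv (Dv f) (0, 0); f\<^sub>v\<^sub>w = Dw (Dv f) (0, 0); f\<^sub>w\<^sub>w = Dw (Dw f) (0, 0);
          g\<^sub>v\<^sub>v = Dv (Dv g) (0, 0); g\<^sub>v\<^sub>w = Dw (Dv g) (0, 0); g\<^sub>w\<^sub>w = Dw (Dw g) (0, 0);
          f\<^sub>v\<^sub>v\<^sub>v = Dv (Dv (Dv f)) (0, 0); f\<^sub>v\<^sub>w\<^sub>w = Dw (Dw (Dv f)) (0, 0);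
          g\<^sub>v\<^sub>v\<^sub>w = Dw (Dv (Dv g)) (0, 0); g\<^sub>w\<^sub>w\<^sub>w = Dw (Dw (Dw g)) (0, 0)
      in (f\<^sub>v\<^sub>v\<^sub>v + f\<^sub>v\<^sub>w\<^sub>w + g\<^sub>v\<^sub>v\<^sub>w + g\<^sub>w\<^sub>w\<^sub>w) / 16
       + (f\<^sub>v\<^sub>w * (f\<^sub>v\<^sub>v + f\<^sub>w\<^sub>w) - g\<^sub>v\<^sub>w * (g\<^sub>v\<^sub>v + g\<^sub>w\<^sub>w) - f\<^sub>v\<^sub>v * g\<^sub>v\<^sub>v + f\<^sub>w\<^sub>w * g\<^sub>w\<^sub>w) / (16 * \<omega>))"

definition smooth_subcritical ::
  "real \<Rightarrow> (real \<times> real \<Rightarrow> real) \<Rightarrow> (real \<times> real \<Rightarrow> real) \<Rightarrow> bool" where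
  "smooth_subcritical \<omega> f g \<longleftrightarrow> smooth_hopf \<omega> f g \<and> first_lyapunov \<omega> f g > 0"

definition smooth_supercritical ::
  "real \<Rightarrow> (real \<times> real \<Rightarrow> real) \<Rightarrow> (real \<times> real \<Rightarrow> real) \<Rightarrow> bool" where
  "smooth_supercritical \<omega> f g \<longleftrightarrow> smooth_hopf \<omega> f g \<and> first_lyapunov \<omega> f g < 0"

text \<open>The nonsmooth system has no criticality if \<open>sigma_sharp a b = 0\<close>; nothing is asserted
  then.\<close>

definition opposite_criticality ::
  "real \<Rightarrow> real^2^2 \<Rightarrow> real^2^2 \<Rightarrow> (real \<times> real \<Rightarrow> real) \<Rightarrow> (real \<times> real \<Rightarrow> real) \<Rightarrow> bool" where
  "opposite_criticality \<omega> a b f g \<longleftrightarrow>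
     (nonsmooth_subcritical a b \<longrightarrow> smooth_supercritical \<omega> f g) \<and>
     (nonsmooth_supercritical a b \<longrightarrow> smooth_subcritical \<omega> f g)"

definition smooth_convex_abs_approx :: "(real \<Rightarrow> real \<Rightarrow> real) \<Rightarrow> bool" where
  "smooth_convex_abs_approx s \<longleftrightarrow>
     (\<forall>\<epsilon>>0. smooth (s \<epsilon>) \<and> convex_on UNIV (s \<epsilon>) \<and> (\<forall>x. s \<epsilon> (- x) = s \<epsilon> x)) \<and>
     Linf_tendsto UNIV s abs"

end

theory Submission
  imports Defs
begin

text \<open>
  Replace \<open>\<bar>y\<bar>\<close> by \<open>sqrt (y\<^sup>2 + \<delta>\<^sup>2) - \<delta> = y\<^sup>2 / (sqrt (y\<^sup>2 + \<delta>\<^sup>2) + \<delta>)\<close>, whose second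
  derivative at \<open>0\<close> is \<open>1 / \<delta>\<close>. The nonlinearity then vanishes to third order at \<open>0\<close>, so that
  the first Lyapunov coefficient is linear in the third derivatives. With \<open>\<delta> = \<epsilon> / l\<close>, where the
  factor \<open>l > 0\<close> may differ from term to term, it is a positive multiple of
  \<open>3 a\<^sub>1\<^sub>1 l\<^sub>1 + a\<^sub>1\<^sub>2 l\<^sub>2 + b\<^sub>2\<^sub>1 l\<^sub>3 + 3 b\<^sub>2\<^sub>2 l\<^sub>4\<close>. A large factor on a coefficient of the
  desired sign gives this sum that sign. Uniform convergence on the whole plane is obtained by
  letting \<open>\<delta>\<close> in a term \<open>x \<bar>y\<bar>\<close> decay like \<open>1 / \<bar>x\<bar>\<close>.
\<close>

subsection \<open>Calculus of smooth functions\<close>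

text \<open>By uniqueness of the derivative, any explicit formula \<open>f'\<close> may stand for
  \<open>frechet_derivative\<close>. The closure rules for \<open>Ck\<close> then follow by
  induction on the order, fed with the usual differentiation rules.\<close>

lemma Ck_SucI:
  assumes "\<And>x. (f has_derivative f' x) (at x)" "\<And>h. Ck k (\<lambda>x. f' x h)"
  shows "Ck (Suc k) f"
proof -
  have "frechet_derivative f (at x) = f' x" for x
    using frechet_derivative_at[OF assms(1)[of x]] by simp
  then show ?thesis
    using assms by (auto simp: differentiable_def)
qed

text \<open>Differentiability gives continuity at the bottom level. The product and power rules rely
  on this, since their derivatives still contain undifferentiated factors.\<close>

lemma Ck_SucD: "Ck (Suc k) f \<Longrightarrow> Ck k f"
proof (induction k arbitrary: f)
  case 0
  then show ?case
    by (auto intro!: continuous_at_imp_continuous_on differentiable_imp_continuous_within)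
qed auto

lemma Ck_Suc_has_derivative:
  "Ck (Suc k) f \<Longrightarrow> (f has_derivative frechet_derivative f (at x)) (at x)"
  by (auto simp: frechet_derivative_works)

lemma Ck_const [simp]: "Ck k (\<lambda>x. c)"
proof (induction k arbitrary: c)
  case (Suc k)
  show ?case by (rule Ck_SucI[OF has_derivative_const]) (rule Suc)
qed simp

lemma Ck_bounded_linear: "bounded_linear f \<Longrightarrow> Ck k f"
proof (cases k)
  case 0
  then show "bounded_linear f \<Longrightarrow> Ck k f"
    by (simp add: linear_continuous_on)
next
  case (Suc n)
  assume "bounded_linear f"
  then show "Ck k f"
    unfolding Suc by (intro Ck_SucI[where f' = "\<lambda>_. f"] bounded_linear_imp_has_derivative) auto
qed

lemma Ck_add: "Ck k f \<Longrightarrow> Ck k g \<Longrightarrow> Ck k (\<lambda>x. f x + g x)"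
proof (induction k arbitrary: f g)
  case 0
  then show ?case by (auto intro: continuous_intros)
next
  case (Suc k)
  show ?case
    by (rule Ck_SucI[OF has_derivative_add[OF Suc.prems[THEN Ck_Suc_has_derivative]]])
       (use Suc in auto)
qed

lemma Ck_mult:
  fixes f g :: "'a::real_normed_vector \<Rightarrow> real"
  shows "Ck k f \<Longrightarrow> Ck k g \<Longrightarrow> Ck k (\<lambda>x. f x * g x)"
proof (induction k arbitrary: f g)
  case 0
  then show ?case by (auto intro: continuous_intros)
next
  case (Suc k)
  show ?case
    by (rule Ck_SucI[OF has_derivative_mult[OF Suc.prems[THEN Ck_Suc_has_derivative]]])
       (use Suc Suc.prems[THEN Ck_SucD] in \<open>auto intro!: Ck_add Suc.IH\<close>)
qed

text \<open>Differentiation turns the exponent \<open>c\<close> into \<open>c - 1\<close>, so the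
  induction keeps \<open>c\<close> arbitrary. The exponents 1/2 and -1 yield square roots and
  reciprocals of positive functions.\<close>

lemma Ck_powr:
  fixes f :: "'a::real_normed_vector \<Rightarrow> real"
  assumes "\<And>x. f x > 0"
  shows "Ck k f \<Longrightarrow> Ck k (\<lambda>x. f x powr c)"
proof (induction k arbitrary: c)
  case 0
  then show ?case using assms by (auto intro!: continuous_intros simp: less_imp_neq[symmetric])
next
  case (Suc k)
  have "((\<lambda>x. f x powr c) has_derivative
      (\<lambda>h. c * f x powr (c - 1) * frechet_derivative f (at x) h)) (at x)" for x
    using has_derivative_powr[OF Ck_Suc_has_derivative[OF Suc.prems, of x]
        has_derivative_const[of c] assms[of x] UNIV_I] assms[of x]
    by (simp add: powr_diff algebra_simps)
  then show ?case
    by (rule Ck_SucI) (use Suc Ck_SucD[OF Suc.prems] in \<open>auto intro!: Ck_mult\<close>)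
qed

text \<open>For linear \<open>L\<close> the derivative in direction \<open>h\<close> is again a
  composition with \<open>L\<close>, namely of the derivative of \<open>f\<close> in the fixed
  direction \<open>L h\<close>, and so the induction closes.\<close>

lemma Ck_compose_bounded_linear:
  assumes L: "bounded_linear L"
  shows "Ck k f \<Longrightarrow> Ck k (\<lambda>x. f (L x))"
proof (induction k arbitrary: f)
  case 0
  then show ?case
    by (auto intro: continuous_on_compose2[of UNIV] linear_continuous_on L)
next
  case (Suc k)
  have "((\<lambda>x. f (L x)) has_derivative (\<lambda>h. frechet_derivative f (at (L x)) (L h))) (at x)" for x
    by (rule has_derivative_compose[OF bounded_linear_imp_has_derivative[OF L]
          Ck_Suc_has_derivative[OF Suc.prems]])
  then show ?case
    by (rule Ck_SucI) (use Suc in auto)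
qed

named_theorems smooth_intros

lemma smooth_const [smooth_intros]: "smooth (\<lambda>x. c)"
  by (simp add: smooth_def)

lemma smooth_bounded_linear: "bounded_linear f \<Longrightarrow> smooth f"
  by (simp add: smooth_def Ck_bounded_linear)

lemma smooth_ident [smooth_intros]: "smooth (\<lambda>x. x)"
  by (simp add: smooth_bounded_linear bounded_linear_ident)

lemma smooth_fst [smooth_intros]: "smooth fst" and smooth_snd [smooth_intros]: "smooth snd"
  by (simp_all add: smooth_bounded_linear bounded_linear_fst bounded_linear_snd)

lemma smooth_add [smooth_intros]: "smooth f \<Longrightarrow> smooth g \<Longrightarrow> smooth (\<lambda>x. f x + g x)"
  by (simp add: smooth_def Ck_add)

lemma smooth_mult [smooth_intros]:
  fixes f g :: "'a::real_normed_vector \<Rightarrow> real"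
  shows "smooth f \<Longrightarrow> smooth g \<Longrightarrow> smooth (\<lambda>x. f x * g x)"
  by (simp add: smooth_def Ck_mult)

lemma smooth_diff [smooth_intros]:
  fixes f g :: "'a::real_normed_vector \<Rightarrow> real"
  shows "smooth f \<Longrightarrow> smooth g \<Longrightarrow> smooth (\<lambda>x. f x - g x)"
  using smooth_add[of f "\<lambda>x. - 1 * g x"] smooth_mult[OF smooth_const, of g "- 1"] by simp

lemma smooth_power [smooth_intros]:
  fixes f :: "'a::real_normed_vector \<Rightarrow> real"
  shows "smooth f \<Longrightarrow> smooth (\<lambda>x. f x ^ n)"
  by (induction n) (auto intro: smooth_intros)

lemma smooth_sqrt [smooth_intros]:
  fixes f :: "'a::real_normed_vector \<Rightarrow> real"
  assumes "\<And>x. f x > 0" "smooth f"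
  shows "smooth (\<lambda>x. sqrt (f x))"
  using assms by (simp add: smooth_def Ck_powr powr_half_sqrt[symmetric] less_imp_le)

lemma smooth_divide [smooth_intros]:
  fixes f g :: "'a::real_normed_vector \<Rightarrow> real"
  assumes "smooth f" "\<And>x. g x > 0" "smooth g"
  shows "smooth (\<lambda>x. f x / g x)"
proof -
  have "(\<lambda>x. f x / g x) = (\<lambda>x. f x * g x powr - 1)"
    using assms(2) by (simp add: powr_minus divide_inverse less_imp_le)
  moreover have "Ck k (\<lambda>x. f x * g x powr - 1)" for k
    using assms by (intro Ck_mult Ck_powr) (auto simp: smooth_def)
  ultimately show ?thesis
    by (simp add: smooth_def)
qed

lemma smooth_compose_bounded_linear:
  "bounded_linear L \<Longrightarrow> smooth f \<Longrightarrow> smooth (\<lambda>x. f (L x))"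
  by (simp add: smooth_def Ck_compose_bounded_linear)

lemma smooth_has_derivative:
  "smooth f \<Longrightarrow> (f has_derivative frechet_derivative f (at x)) (at x)"
  unfolding smooth_def using Ck_Suc_has_derivative by blast

lemma smooth_frechet_derivative: "smooth f \<Longrightarrow> smooth (\<lambda>x. frechet_derivative f (at x) h)"
  unfolding smooth_def by (metis Ck.simps(2))

lemma smooth_imp_continuous_on: "smooth f \<Longrightarrow> continuous_on UNIV f"
  unfolding smooth_def by (metis Ck.simps(1))

subsection \<open>Partial derivatives of cubic germs\<close>

text \<open>As a Frechet derivative in a fixed direction, the partial derivative of a smooth
  function is smooth again, so that partials can be iterated.\<close>

lemma Dv_eq_frechet_derivative:
  assumes "smooth f"
  shows "Dv f = (\<lambda>p. frechet_derivative f (at p) (1, 0))"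
proof
  fix p :: "real \<times> real"
  obtain v w where p: "p = (v, w)" by fastforce
  have lin: "bounded_linear (frechet_derivative f (at p))"
    using smooth_has_derivative[OF assms] by (rule has_derivative_bounded_linear)
  have "((\<lambda>x. f (x, w)) has_derivative (\<lambda>h. frechet_derivative f (at p) (h, 0))) (at v)"
    unfolding p
    by (rule has_derivative_compose[OF _ smooth_has_derivative[OF assms], of "\<lambda>x. (x, w)"])
       (auto intro!: derivative_eq_intros)
  also have "(\<lambda>h. frechet_derivative f (at p) (h, 0)) = (*) (frechet_derivative f (at p) (1, 0))"
  proof
    fix h :: real
    show "frechet_derivative f (at p) (h, 0) = frechet_derivative f (at p) (1, 0) * h"
      using linear_simps(5)[OF lin, of h "(1, 0)"] by (simp add: mult.commute)
  qed
  finally show "Dv f p = frechet_derivative f (at p) (1, 0)"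
    by (simp add: p Dv_def DERIV_imp_deriv has_field_derivative_def)
qed

lemma Dw_eq_frechet_derivative:
  assumes "smooth f"
  shows "Dw f = (\<lambda>p. frechet_derivative f (at p) (0, 1))"
proof
  fix p :: "real \<times> real"
  obtain v w where p: "p = (v, w)" by fastforce
  have lin: "bounded_linear (frechet_derivative f (at p))"
    using smooth_has_derivative[OF assms] by (rule has_derivative_bounded_linear)
  have "((\<lambda>y. f (v, y)) has_derivative (\<lambda>h. frechet_derivative f (at p) (0, h))) (at w)"
    unfolding p
    by (rule has_derivative_compose[OF _ smooth_has_derivative[OF assms], of "\<lambda>y. (v, y)"])
       (auto intro!: derivative_eq_intros)
  also have "(\<lambda>h. frechet_derivative f (at p) (0, h)) = (*) (frechet_derivative f (at p) (0, 1))"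
  proof
    fix h :: real
    show "frechet_derivative f (at p) (0, h) = frechet_derivative f (at p) (0, 1) * h"
      using linear_simps(5)[OF lin, of h "(0, 1)"] by (simp add: mult.commute)
  qed
  finally show "Dw f p = frechet_derivative f (at p) (0, 1)"
    by (simp add: p Dw_def DERIV_imp_deriv has_field_derivative_def)
qed

lemma smooth_Dv [smooth_intros]: "smooth f \<Longrightarrow> smooth (Dv f)"
  and smooth_Dw [smooth_intros]: "smooth f \<Longrightarrow> smooth (Dw f)"
  by (simp_all add: Dv_eq_frechet_derivative Dw_eq_frechet_derivative smooth_frechet_derivative)

lemma partial_linear:
  "Dv (\<lambda>p. c) = (\<lambda>p. 0)" "Dw (\<lambda>p. c) = (\<lambda>p. 0)"
  "Dv fst = (\<lambda>p. 1)" "Dw fst = (\<lambda>p. 0)" "Dv snd = (\<lambda>p. 0)" "Dw snd = (\<lambda>p. 1)"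
  by (auto simp: Dv_def Dw_def)

lemma
  assumes "smooth f" "smooth g"
  shows Dv_add: "Dv (\<lambda>p. f p + g p) = (\<lambda>p. Dv f p + Dv g p)"
    and Dw_add: "Dw (\<lambda>p. f p + g p) = (\<lambda>p. Dw f p + Dw g p)"
proof -
  have "frechet_derivative (\<lambda>p. f p + g p) (at p) =
      (\<lambda>h. frechet_derivative f (at p) h + frechet_derivative g (at p) h)" for p
    using frechet_derivative_at[OF has_derivative_add[OF assms[THEN smooth_has_derivative]]] by simp
  then show "Dv (\<lambda>p. f p + g p) = (\<lambda>p. Dv f p + Dv g p)"
    "Dw (\<lambda>p. f p + g p) = (\<lambda>p. Dw f p + Dw g p)"
    using assms by (simp_all add: Dv_eq_frechet_derivative Dw_eq_frechet_derivative smooth_add)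
qed

lemma
  assumes "smooth f" "smooth g"
  shows Dv_mult: "Dv (\<lambda>p. f p * g p) = (\<lambda>p. f p * Dv g p + Dv f p * g p)"
    and Dw_mult: "Dw (\<lambda>p. f p * g p) = (\<lambda>p. f p * Dw g p + Dw f p * g p)"
proof -
  have "frechet_derivative (\<lambda>p. f p * g p) (at p) =
      (\<lambda>h. f p * frechet_derivative g (at p) h + frechet_derivative f (at p) h * g p)" for p
    using frechet_derivative_at[OF has_derivative_mult[OF assms[THEN smooth_has_derivative]]] by simp
  then show "Dv (\<lambda>p. f p * g p) = (\<lambda>p. f p * Dv g p + Dv f p * g p)"
    "Dw (\<lambda>p. f p * g p) = (\<lambda>p. f p * Dw g p + Dw f p * g p)"
    using assms by (simp_all add: Dv_eq_frechet_derivative Dw_eq_frechet_derivative smooth_mult)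
qed

text \<open>Leibniz rule at the origin: a term survives only if exactly one derivative hits the
  factor v. Hence m derivatives in v give m times the partial of \<open>F\<close> with one
  v-derivative fewer, and 0 if m = 0.\<close>

lemma partials_fst_mult:
  assumes "smooth F"
  defines "f \<equiv> \<lambda>p. fst p * F p"
  shows "Dv f (0, 0) = F (0, 0)" "Dw f (0, 0) = 0"
    "Dv (Dv f) (0, 0) = 2 * Dv F (0, 0)" "Dw (Dv f) (0, 0) = Dw F (0, 0)" "Dw (Dw f) (0, 0) = 0"
    "Dv (Dv (Dv f)) (0, 0) = 3 * Dv (Dv F) (0, 0)"
    "Dw (Dv (Dv f)) (0, 0) = 2 * Dw (Dv F) (0, 0)"
    "Dw (Dw (Dv f)) (0, 0) = Dw (Dw F) (0, 0)"
    "Dw (Dw (Dw f)) (0, 0) = 0"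
  unfolding f_def
  by (simp_all add: Dv_add Dw_add Dv_mult Dw_mult partial_linear smooth_intros assms(1))

lemma partials_snd_mult:
  assumes "smooth F"
  defines "f \<equiv> \<lambda>p. snd p * F p"
  shows "Dv f (0, 0) = 0" "Dw f (0, 0) = F (0, 0)"
    "Dv (Dv f) (0, 0) = 0" "Dw (Dv f) (0, 0) = Dv F (0, 0)" "Dw (Dw f) (0, 0) = 2 * Dw F (0, 0)"
    "Dv (Dv (Dv f)) (0, 0) = 0"
    "Dw (Dv (Dv f)) (0, 0) = Dv (Dv F) (0, 0)"
    "Dw (Dw (Dv f)) (0, 0) = 2 * Dw (Dv F) (0, 0)"
    "Dw (Dw (Dw f)) (0, 0) = 3 * Dw (Dw F) (0, 0)"
  unfolding f_def
  by (simp_all add: Dv_add Dw_add Dv_mult Dw_mult partial_linear smooth_intros assms(1))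

text \<open>A sum of monomials x_i * x_j^2 with smooth, not necessarily constant, cofactors
  \<open>K i j\<close>. The nesting exposes one coordinate factor at a time to
  \<open>partials_fst_mult\<close> and \<open>partials_snd_mult\<close>.\<close>

definition cubic_germ ::
  "(2 \<Rightarrow> 2 \<Rightarrow> real \<times> real \<Rightarrow> real) \<Rightarrow> real \<times> real \<Rightarrow> real" where
  "cubic_germ K = (\<lambda>p.
      fst p * (fst p * (fst p * K 1 1 p)) + fst p * (snd p * (snd p * K 1 2 p))
    + snd p * (fst p * (fst p * K 2 1 p)) + snd p * (snd p * (snd p * K 2 2 p)))"

lemma smooth_cubic_germ: "(\<And>i j. smooth (K i j)) \<Longrightarrow> smooth (cubic_germ K)"
  unfolding cubic_germ_def by (intro smooth_intros)

text \<open>To third order the germ agrees with the cubic form whose coefficients are the values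
  \<open>K i j (0, 0)\<close>; variations of the cofactors enter only at higher order.\<close>

lemma cubic_germ_partials:
  assumes "\<And>i j. smooth (K i j)"
  defines "f \<equiv> cubic_germ K"
  shows "Dv (Dv f) (0, 0) = 0" "Dw (Dv f) (0, 0) = 0" "Dw (Dw f) (0, 0) = 0"
    "Dv (Dv (Dv f)) (0, 0) = 6 * K 1 1 (0, 0)"
    "Dw (Dw (Dv f)) (0, 0) = 2 * K 1 2 (0, 0)"
    "Dw (Dv (Dv f)) (0, 0) = 2 * K 2 1 (0, 0)"
    "Dw (Dw (Dw f)) (0, 0) = 6 * K 2 2 (0, 0)"
  unfolding f_def cubic_germ_def
  by (simp_all add: Dv_add Dw_add partials_fst_mult partials_snd_mult smooth_intros assms(1))

lemma smooth_hopf_cubic_germ: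
  assumes "\<omega> \<noteq> 0" "\<And>i j. smooth (K i j)" "\<And>i j. smooth (L i j)"
  shows "smooth_hopf \<omega> (cubic_germ K) (cubic_germ L)"
proof -
  have der: "(cubic_germ M has_derivative (\<lambda>h. 0)) (at (0, 0))" if "\<And>i j. smooth (M i j)" for M
    unfolding cubic_germ_def
    by (rule derivative_eq_intros smooth_has_derivative[OF that] refl | simp add: fun_eq_iff)+
  have "(planar_field \<mu> \<omega> (cubic_germ K) (cubic_germ L) has_derivative
      (\<lambda>(v, w). (\<mu> * v - \<omega> * w, \<omega> * v + \<mu> * w))) (at (0, 0))" for \<mu>
    unfolding planar_field_def case_prod_beta prod.collapse
    by (rule derivative_eq_intros der assms refl | simp)+
  then show ?thesis
    using assms smooth_cubic_germ[of K] smooth_cubic_germ[of L]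
    by (simp add: smooth_hopf_def) (simp add: planar_field_def cubic_germ_def)
qed

text \<open>All second partials vanish at the origin, which removes the quadratic part of the
  formula and with it the dependence on \<open>\<omega>\<close>.\<close>

lemma first_lyapunov_cubic_germ:
  assumes "\<And>i j. smooth (K i j)" "\<And>i j. smooth (L i j)"
  shows "first_lyapunov \<omega> (cubic_germ K) (cubic_germ L) =
    (6 * K 1 1 (0, 0) + 2 * K 1 2 (0, 0) + 2 * L 2 1 (0, 0) + 6 * L 2 2 (0, 0)) / 16"
  by (simp add: first_lyapunov_def cubic_germ_partials assms)

subsection \<open>Smoothing the absolute value\<close>

text \<open>Continuity supplies the measurability needed to bound an essential supremum by a
  pointwise estimate on \<open>S\<close>; the norm is then squeezed between 0 and
  \<open>C * \<epsilon>\<close>.\<close>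

lemma Linf_tendsto_linear_rate:
  fixes F :: "real \<Rightarrow> 'a::euclidean_space \<Rightarrow> 'b::euclidean_space"
  assumes "\<And>\<epsilon>. \<epsilon> > 0 \<Longrightarrow> continuous_on UNIV (F \<epsilon>)" "continuous_on UNIV f"
    and bound: "\<And>\<epsilon> x. \<epsilon> > 0 \<Longrightarrow> x \<in> S \<Longrightarrow> norm (F \<epsilon> x - f x) \<le> C * \<epsilon>"
  shows "Linf_tendsto S F f"
proof -
  have "Linf_norm S (\<lambda>x. F \<epsilon> x - f x) \<le> ennreal (C * \<epsilon>)" if "\<epsilon> > 0" for \<epsilon>
    unfolding Linf_norm_def
  proof (rule esssup_I)
    have "continuous_on UNIV (\<lambda>x. norm (F \<epsilon> x - f x))"
      using assms that by (intro continuous_intros) auto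
    then have "(\<lambda>x. norm (F \<epsilon> x - f x)) \<in> borel_measurable lborel"
      by (simp add: borel_measurable_continuous_onI)
    then show "(\<lambda>x. ennreal (norm (F \<epsilon> x - f x))) \<in> borel_measurable (restrict_space lborel S)"
      by (intro measurable_restrict_space1) simp
    show "AE x in restrict_space lborel S. ennreal (norm (F \<epsilon> x - f x)) \<le> ennreal (C * \<epsilon>)"
      by (rule AE_I2) (simp add: space_restrict_space bound[OF that] ennreal_leI)
  qed
  then have "\<forall>\<^sub>F \<epsilon> in at_right 0. Linf_norm S (\<lambda>x. F \<epsilon> x - f x) \<le> ennreal (C * \<epsilon>)"
    by (rule eventually_mono[OF eventually_at_right_less])
  moreover have "((\<lambda>\<epsilon>. C * \<epsilon>) \<longlongrightarrow> C * 0) (at_right 0)"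
    by (intro tendsto_intros)
  then have "((\<lambda>\<epsilon>. ennreal (C * \<epsilon>)) \<longlongrightarrow> 0) (at_right 0)"
    using tendsto_ennrealI by fastforce
  ultimately show ?thesis
    unfolding Linf_tendsto_def
    by (rule tendsto_sandwich[OF always_eventually _ tendsto_const, rotated]) simp
qed

text \<open>The subtraction of \<open>\<delta>\<close> keeps the linearization at the equilibrium unchanged.\<close>

definition soft_abs :: "real \<Rightarrow> real \<Rightarrow> real" where
  "soft_abs \<delta> y = sqrt (y\<^sup>2 + \<delta>\<^sup>2) - \<delta>"

lemma soft_abs_minus [simp]: "soft_abs \<delta> (- y) = soft_abs \<delta> y"
  by (simp add: soft_abs_def)

text \<open>Multiplication by the conjugate exhibits the factor y^2, leaving a denominator that is
  positive everywhere.\<close>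

lemma soft_abs_eq_divide:
  assumes "\<delta> > 0"
  shows "soft_abs \<delta> y = y * y / (sqrt (y\<^sup>2 + \<delta>\<^sup>2) + \<delta>)"
proof -
  have "(sqrt (y\<^sup>2 + \<delta>\<^sup>2) - \<delta>) * (sqrt (y\<^sup>2 + \<delta>\<^sup>2) + \<delta>) = y * y"
    by (simp add: algebra_simps flip: power2_eq_square)
  moreover have "sqrt (y\<^sup>2 + \<delta>\<^sup>2) + \<delta> > 0"
    using assms by (simp add: add_nonneg_pos)
  ultimately show ?thesis
    by (simp add: soft_abs_def field_simps)
qed

lemma abs_soft_abs_diff_le:
  assumes "\<delta> > 0"
  shows "\<bar>soft_abs \<delta> y - \<bar>y\<bar>\<bar> \<le> \<delta>"
proof -
  have "\<bar>y\<bar> \<le> sqrt (y\<^sup>2 + \<delta>\<^sup>2)" "sqrt (y\<^sup>2 + \<delta>\<^sup>2) \<le> \<bar>y\<bar> + \<delta>"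
    using assms sqrt_sum_squares_le_sum_abs[of y \<delta>] by auto
  then show ?thesis
    by (simp add: soft_abs_def)
qed

lemma smooth_soft_abs: "\<delta> > 0 \<Longrightarrow> smooth (soft_abs \<delta>)"
  unfolding soft_abs_def
  by (intro smooth_diff smooth_sqrt smooth_add smooth_power smooth_ident smooth_const)
     (simp add: add_nonneg_pos)

text \<open>Up to the constant \<open>\<delta>\<close>, this is the Euclidean norm restricted to the
  line of points \<open>(y, \<delta>)\<close>, so the triangle inequality gives convexity.\<close>

lemma convex_on_soft_abs: "convex_on UNIV (soft_abs \<delta>)"
proof (rule convex_onI)
  fix t x y :: real
  assume t: "0 < t" "t < 1"
  have "norm ((1 - t) *\<^sub>R (x, \<delta>) + t *\<^sub>R (y, \<delta>)) \<le> (1 - t) * norm (x, \<delta>) + t * norm (y, \<delta>)"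
    using norm_triangle_ineq[of "(1 - t) *\<^sub>R (x, \<delta>)" "t *\<^sub>R (y, \<delta>)"] t
    by (simp only: norm_scaleR)
  moreover have "(1 - t) *\<^sub>R (x, \<delta>) + t *\<^sub>R (y, \<delta>) = ((1 - t) *\<^sub>R x + t *\<^sub>R y, \<delta>)"
    by (simp add: algebra_simps)
  ultimately have "norm ((1 - t) *\<^sub>R x + t *\<^sub>R y, \<delta>) \<le> (1 - t) * norm (x, \<delta>) + t * norm (y, \<delta>)"
    by metis
  then show "soft_abs \<delta> ((1 - t) *\<^sub>R x + t *\<^sub>R y) \<le> (1 - t) * soft_abs \<delta> x + t * soft_abs \<delta> y"
    by (simp add: soft_abs_def norm_Pair algebra_simps)
qed simp

lemma smooth_convex_abs_approx_soft_abs: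
  assumes "l > 0"
  shows "smooth_convex_abs_approx (\<lambda>\<epsilon>. soft_abs (\<epsilon> / l))"
proof -
  have "Linf_tendsto UNIV (\<lambda>\<epsilon>. soft_abs (\<epsilon> / l)) abs"
  proof (rule Linf_tendsto_linear_rate[where C = "1 / l"])
    show "norm (soft_abs (\<epsilon> / l) x - \<bar>x\<bar>) \<le> 1 / l * \<epsilon>" if "\<epsilon> > 0" for \<epsilon> x
      using abs_soft_abs_diff_le[of "\<epsilon> / l" x] assms that by simp
    show "continuous_on UNIV (soft_abs (\<epsilon> / l))" if "\<epsilon> > 0" for \<epsilon>
      using assms that by (simp add: smooth_imp_continuous_on smooth_soft_abs)
    show "continuous_on UNIV (abs :: real \<Rightarrow> real)"
      by (intro continuous_intros)
  qed
  then show ?thesis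
    using assms by (simp add: smooth_convex_abs_approx_def smooth_soft_abs convex_on_soft_abs)
qed

text \<open>The profile \<open>\<rho>\<close> is constant for a genuine replacement of the absolute values and
  \<open>\<rho> x = 1 / sqrt (1 + x\<^sup>2)\<close> for convergence on the whole plane.\<close>

definition soft_term ::
  "(real \<Rightarrow> real) \<Rightarrow> (2 \<Rightarrow> 2 \<Rightarrow> real) \<Rightarrow> real^2^2 \<Rightarrow> real \<Rightarrow> real \<times> real \<Rightarrow> real" where
  "soft_term \<rho> l c \<epsilon> = (\<lambda>(v, w).
      c $ 1 $ 1 * v * soft_abs (\<epsilon> / l 1 1 * \<rho> v) v + c $ 1 $ 2 * v * soft_abs (\<epsilon> / l 1 2 * \<rho> v) w
    + c $ 2 $ 1 * w * soft_abs (\<epsilon> / l 2 1 * \<rho> w) v + c $ 2 $ 2 * w * soft_abs (\<epsilon> / l 2 2 * \<rho> w) w)"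

lemma soft_term_one: "soft_term (\<lambda>_. 1) l c \<epsilon> = quad_term (\<lambda>i j. soft_abs (\<epsilon> / l i j)) c"
  by (simp add: soft_term_def quad_term_def)

lemma soft_term_cubic_germ:
  assumes "\<epsilon> > 0" "\<And>i j. l i j > 0" "smooth \<rho>" "\<And>x. \<rho> x > 0" "\<rho> 0 = 1"
  obtains K where "\<And>i j. smooth (K i j)" "\<And>i j. K i j (0, 0) = c $ i $ j * l i j / (2 * \<epsilon>)"
    "soft_term \<rho> l c \<epsilon> = cubic_germ K"
proof -
  \<comment> \<open>Indexing the coordinates by \<open>i\<close> treats all four summands at once:
    the summand \<open>(i,j)\<close> is x_i times a smoothing of the absolute value of x_j, with
    width governed by x_i.\<close>
  define X :: "2 \<Rightarrow> real \<times> real \<Rightarrow> real" where "X i = (if i = 1 then fst else snd)" for i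
  define \<delta> where "\<delta> i j p = \<epsilon> / l i j * \<rho> (X i p)" for i j p
  define K where "K i j p = c $ i $ j / (sqrt ((X j p)\<^sup>2 + (\<delta> i j p)\<^sup>2) + \<delta> i j p)" for i j p
  have X: "bounded_linear (X i)" for i
    by (simp add: X_def bounded_linear_fst bounded_linear_snd)
  have pos: "\<delta> i j p > 0" for i j p
    using assms by (simp add: \<delta>_def)
  have smooth_\<delta>: "smooth (\<lambda>p. \<delta> i j p)" for i j
    unfolding \<delta>_def
    by (rule smooth_mult[OF smooth_const smooth_compose_bounded_linear[OF X assms(3)]])
  have smooth_K: "smooth (K i j)" for i j
  proof -
    have pos': "0 < (X j p)\<^sup>2 + (\<delta> i j p)\<^sup>2" "0 < sqrt ((X j p)\<^sup>2 + (\<delta> i j p)\<^sup>2) + \<delta> i j p" for p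
      using pos[of i j p] by (auto intro!: add_nonneg_pos)
    show ?thesis
      unfolding K_def
      by (intro smooth_divide smooth_add smooth_sqrt smooth_power smooth_const smooth_\<delta>
          smooth_bounded_linear[OF X] pos')
  qed
  \<comment> \<open>At the origin the square root equals \<open>\<epsilon> / l i j\<close>, and so
    does the second summand of the denominator; hence the factor 2.\<close>
  have K_0: "K i j (0, 0) = c $ i $ j * l i j / (2 * \<epsilon>)" for i j
  proof -
    have "X n (0, 0) = 0" for n
      by (simp add: X_def)
    then have "K i j (0, 0) = c $ i $ j / (\<epsilon> / l i j + \<epsilon> / l i j)"
      using assms(1,5) assms(2)[of i j] by (simp add: K_def \<delta>_def)
    then show ?thesis
      using assms(1) assms(2)[of i j] by (simp add: field_simps)
  qed
  have "c $ i $ j * X i p * soft_abs (\<delta> i j p) (X j p) = X i p * (X j p * (X j p * K i j p))"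
    for i j p
    by (simp add: K_def soft_abs_eq_divide[OF pos])
  note monomial = this[unfolded \<delta>_def]
  have "X 1 = fst" "X 2 = snd"
    by (simp_all add: X_def)
  then have "soft_term \<rho> l c \<epsilon> = cubic_germ K"
    using monomial[of 1 1] monomial[of 1 2] monomial[of 2 1] monomial[of 2 2]
    unfolding soft_term_def cubic_germ_def case_prod_beta by (simp only:)
  with smooth_K K_0 show thesis
    by (rule that)
qed

text \<open>Halving the factors 6 and 2 of the cubic germ leaves the ratio 3 : 1, against 2 : 1 in
  \<open>sigma_sharp\<close>. The weights \<open>\<alpha>\<close> and \<open>\<beta>\<close>
  multiply the single coefficients and can thus change the sign of the sum.\<close>

lemma soft_term_hopf:
  assumes "\<omega> \<noteq> 0" "\<epsilon> > 0" "\<And>i j. \<alpha> i j > 0" "\<And>i j. \<beta> i j > 0"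
    "smooth \<rho>" "\<And>x. \<rho> x > 0" "\<rho> 0 = 1"
  shows "smooth_hopf \<omega> (soft_term \<rho> \<alpha> a \<epsilon>) (soft_term \<rho> \<beta> b \<epsilon>)"
    and "first_lyapunov \<omega> (soft_term \<rho> \<alpha> a \<epsilon>) (soft_term \<rho> \<beta> b \<epsilon>) =
      (3 * a $ 1 $ 1 * \<alpha> 1 1 + a $ 1 $ 2 * \<alpha> 1 2 + b $ 2 $ 1 * \<beta> 2 1 + 3 * b $ 2 $ 2 * \<beta> 2 2)
      / (16 * \<epsilon>)"
proof -
  obtain K where K: "\<And>i j. smooth (K i j)" "\<And>i j. K i j (0, 0) = a $ i $ j * \<alpha> i j / (2 * \<epsilon>)"
    "soft_term \<rho> \<alpha> a \<epsilon> = cubic_germ K"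
    using soft_term_cubic_germ[of \<epsilon> \<alpha> \<rho> a] assms by metis
  obtain L where L: "\<And>i j. smooth (L i j)" "\<And>i j. L i j (0, 0) = b $ i $ j * \<beta> i j / (2 * \<epsilon>)"
    "soft_term \<rho> \<beta> b \<epsilon> = cubic_germ L"
    using soft_term_cubic_germ[of \<epsilon> \<beta> \<rho> b] assms by metis
  show "smooth_hopf \<omega> (soft_term \<rho> \<alpha> a \<epsilon>) (soft_term \<rho> \<beta> b \<epsilon>)"
    by (simp add: K L assms(1) smooth_hopf_cubic_germ)
  show "first_lyapunov \<omega> (soft_term \<rho> \<alpha> a \<epsilon>) (soft_term \<rho> \<beta> b \<epsilon>) =
      (3 * a $ 1 $ 1 * \<alpha> 1 1 + a $ 1 $ 2 * \<alpha> 1 2 + b $ 2 $ 1 * \<beta> 2 1 + 3 * b $ 2 $ 2 * \<beta> 2 2)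
      / (16 * \<epsilon>)"
    using assms(2) by (simp add: K L first_lyapunov_cubic_germ field_simps)
qed

lemma abs_soft_term_diff_le:
  assumes "\<epsilon> > 0" "\<And>i j. l i j > 0" "\<And>x. \<rho> x > 0"
    and "\<bar>v\<bar> * \<rho> v \<le> B" "\<bar>w\<bar> * \<rho> w \<le> B"
  shows "\<bar>soft_term \<rho> l c \<epsilon> (v, w) - abs_term c (v, w)\<bar> \<le>
    (\<bar>c $ 1 $ 1\<bar> / l 1 1 + \<bar>c $ 1 $ 2\<bar> / l 1 2 + \<bar>c $ 2 $ 1\<bar> / l 2 1 + \<bar>c $ 2 $ 2\<bar> / l 2 2) * B * \<epsilon>"
proof -
  \<comment> \<open>Estimate for one summand: the smoothing error is at most its width
    \<open>\<epsilon> / m * \<rho> x\<close>, and the prefactor \<open>x\<close> is absorbed by the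
    bound \<open>B\<close> on \<open>\<bar>x\<bar> * \<rho> x\<close>.\<close>
  have *: "\<bar>d * x * soft_abs (\<epsilon> / m * \<rho> x) y - d * x * \<bar>y\<bar>\<bar> \<le> \<bar>d\<bar> / m * B * \<epsilon>"
    if "m > 0" "\<bar>x\<bar> * \<rho> x \<le> B" for d x y m
  proof -
    have "\<epsilon> / m * \<rho> x > 0"
      using assms that by simp
    then have "\<bar>d * x\<bar> * \<bar>soft_abs (\<epsilon> / m * \<rho> x) y - \<bar>y\<bar>\<bar> \<le> \<bar>d * x\<bar> * (\<epsilon> / m * \<rho> x)"
      by (intro mult_left_mono abs_soft_abs_diff_le) auto
    also have "\<dots> = \<bar>d\<bar> / m * \<epsilon> * (\<bar>x\<bar> * \<rho> x)"
      by (simp add: abs_mult)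
    also have "\<dots> \<le> \<bar>d\<bar> / m * \<epsilon> * B"
      using assms that by (intro mult_left_mono) auto
    also have "\<bar>d * x\<bar> * \<bar>soft_abs (\<epsilon> / m * \<rho> x) y - \<bar>y\<bar>\<bar> =
        \<bar>d * x * soft_abs (\<epsilon> / m * \<rho> x) y - d * x * \<bar>y\<bar>\<bar>"
      by (simp only: abs_mult[symmetric] right_diff_distrib)
    finally show ?thesis
      by (simp add: mult_ac)
  qed
  show ?thesis
    using *[OF assms(2)[of 1 1] assms(4), of "c $ 1 $ 1" v]
      *[OF assms(2)[of 1 2] assms(4), of "c $ 1 $ 2" w]
      *[OF assms(2)[of 2 1] assms(5), of "c $ 2 $ 1" v]
      *[OF assms(2)[of 2 2] assms(5), of "c $ 2 $ 2" w]
    unfolding soft_term_def quad_term_def case_prod_conv distrib_right abs_le_iff by linarith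
qed

lemma Linf_tendsto_soft_term:
  assumes "\<And>i j. \<alpha> i j > 0" "\<And>i j. \<beta> i j > 0" "smooth \<rho>" "\<And>x. \<rho> x > 0" "\<rho> 0 = 1"
    and B: "\<And>v w. (v, w) \<in> S \<Longrightarrow> \<bar>v\<bar> * \<rho> v \<le> B \<and> \<bar>w\<bar> * \<rho> w \<le> B"
  shows "Linf_tendsto S (\<lambda>\<epsilon> p. (soft_term \<rho> \<alpha> a \<epsilon> p, soft_term \<rho> \<beta> b \<epsilon> p))
    (\<lambda>p. (abs_term a p, abs_term b p))"
proof -
  define C where "C l c = \<bar>c $ 1 $ 1\<bar> / l 1 1 + \<bar>c $ 1 $ 2\<bar> / l 1 2 + \<bar>c $ 2 $ 1\<bar> / l 2 1
    + \<bar>c $ 2 $ 2\<bar> / l 2 2" for l :: "2 \<Rightarrow> 2 \<Rightarrow> real" and c :: "real^2^2"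
  \<comment> \<open>Continuity is read off from the representation as a smooth cubic germ.\<close>
  have cont: "continuous_on UNIV (soft_term \<rho> l c \<epsilon>)" if "\<epsilon> > 0" "\<And>i j. l i j > 0" for l c \<epsilon>
    using soft_term_cubic_germ[of \<epsilon> l \<rho> c] smooth_cubic_germ smooth_imp_continuous_on that assms
    by metis
  have cont_abs: "continuous_on UNIV (abs_term c)" for c
    unfolding quad_term_def case_prod_beta by (intro continuous_intros)
  show ?thesis
  proof (rule Linf_tendsto_linear_rate[where C = "C \<alpha> a * B + C \<beta> b * B"])
    fix \<epsilon> :: real and p
    assume \<epsilon>: "\<epsilon> > 0" and p: "p \<in> S"
    obtain v w where vw: "p = (v, w)" by fastforce
    have "\<bar>soft_term \<rho> l c \<epsilon> p - abs_term c p\<bar> \<le> C l c * B * \<epsilon>" if "\<And>i j. l i j > 0" for l c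
      unfolding vw C_def using B p vw by (intro abs_soft_term_diff_le \<epsilon> that assms(4)) auto
    from this[of \<alpha> a] this[of \<beta> b]
    show "norm ((soft_term \<rho> \<alpha> a \<epsilon> p, soft_term \<rho> \<beta> b \<epsilon> p) - (abs_term a p, abs_term b p))
        \<le> (C \<alpha> a * B + C \<beta> b * B) * \<epsilon>"
      using norm_Pair_le[of "soft_term \<rho> \<alpha> a \<epsilon> p - abs_term a p" "soft_term \<rho> \<beta> b \<epsilon> p - abs_term b p"]
        assms(1,2) by (simp add: distrib_right)
  qed (use assms in \<open>auto intro!: continuous_on_Pair cont cont_abs\<close>)
qed

subsection \<open>Choice of the weights\<close>

text \<open>Three weights are set to 1, and the weight of a positive number is taken large enough to
  outweigh the rest.\<close>

lemma positive_weights: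
  fixes x1 x2 x3 x4 :: real
  assumes "\<exists>x\<in>{x1, x2, x3, x4}. x > 0"
  obtains m1 m2 m3 m4 :: real where "m1 > 0" "m2 > 0" "m3 > 0" "m4 > 0"
    "x1 * m1 + x2 * m2 + x3 * m3 + x4 * m4 > 0"
proof -
  have large: "\<exists>m>0. x * m + y > 0" if "x > 0" for x y :: real
    \<comment> \<open>With this \<open>m\<close> the sum is \<open>\<bar>y\<bar> + 1 + y\<close>,
      which is at least 1.\<close>
    using that by (intro exI[of _ "(\<bar>y\<bar> + 1) / x"]) auto
  from assms consider "x1 > 0" | "x2 > 0" | "x3 > 0" | "x4 > 0" by auto
  then show thesis
  proof cases
    case 1
    with large[of x1 "x2 + x3 + x4"] that[of _ 1 1 1] show thesis by (auto simp: algebra_simps)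
  next
    case 2
    with large[of x2 "x1 + x3 + x4"] that[of 1 _ 1 1] show thesis by (auto simp: algebra_simps)
  next
    case 3
    with large[of x3 "x1 + x2 + x4"] that[of 1 1 _ 1] show thesis by (auto simp: algebra_simps)
  next
    case 4
    with large[of x4 "x1 + x2 + x3"] that[of 1 1 1] show thesis by (auto simp: algebra_simps)
  qed
qed

lemma opposing_weights:
  assumes "sign_change a b"
  obtains \<alpha> \<beta> :: "2 \<Rightarrow> 2 \<Rightarrow> real" where "\<And>i j. \<alpha> i j > 0" "\<And>i j. \<beta> i j > 0"
    "sigma_sharp a b *
      (3 * a $ 1 $ 1 * \<alpha> 1 1 + a $ 1 $ 2 * \<alpha> 1 2 + b $ 2 $ 1 * \<beta> 2 1 + 3 * b $ 2 $ 2 * \<beta> 2 2) < 0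
     \<or> sigma_sharp a b = 0"
proof -
  define s where "s = - sigma_sharp a b"
  show thesis
  proof (cases "s = 0")
    case True
    then show thesis
      using that[of "\<lambda>_ _. 1" "\<lambda>_ _. 1"] by (simp add: s_def)
  next
    case False
    \<comment> \<open>The sign change provides a coefficient with the sign of \<open>s\<close>,
      whichever sign that is; the factors 3 preserve signs.\<close>
    have "\<exists>x\<in>{s * (3 * a $ 1 $ 1), s * a $ 1 $ 2, s * b $ 2 $ 1, s * (3 * b $ 2 $ 2)}. x > 0"
      using assms False by (cases "s > 0") (auto simp: sign_change_def zero_less_mult_iff)
    from positive_weights[OF this] obtain m1 m2 m3 m4 where m: "m1 > 0" "m2 > 0" "m3 > 0" "m4 > 0"
      "s * (3 * a $ 1 $ 1) * m1 + s * a $ 1 $ 2 * m2 + s * b $ 2 $ 1 * m3 + s * (3 * b $ 2 $ 2) * m4 > 0"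
      by metis
    show thesis
      \<comment> \<open>The four relevant coefficients lie in the first row of \<open>a\<close> and
        the second row of \<open>b\<close>, so weights depending on the column alone
        suffice.\<close>
      using m that[of "\<lambda>i j. if j = 1 then m1 else m2" "\<lambda>i j. if j = 1 then m3 else m4"]
      by (simp add: s_def algebra_simps)
  qed
qed

section \<open>Reversal of criticality by both kinds of smoothing\<close>

theorem lemma3p5:
  fixes \<omega> :: real and a b :: "real^2^2"
  assumes "\<omega> \<noteq> 0" and "sign_change a b"
  shows "(\<exists>f g :: real \<Rightarrow> real \<times> real \<Rightarrow> real.
            (\<forall>\<epsilon>>0. smooth_hopf \<omega> (f \<epsilon>) (g \<epsilon>) \<and> opposite_criticality \<omega> a b (f \<epsilon>) (g \<epsilon>)) \<and>
            Linf_tendsto UNIV (\<lambda>\<epsilon> p. (f \<epsilon> p, g \<epsilon> p)) (\<lambda>p. (abs_term a p, abs_term b p)))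
       \<and> (\<exists>\<sigma> \<tau> :: 2 \<Rightarrow> 2 \<Rightarrow> real \<Rightarrow> real \<Rightarrow> real.
            (\<forall>i j. smooth_convex_abs_approx (\<sigma> i j) \<and> smooth_convex_abs_approx (\<tau> i j)) \<and>
            (let f = (\<lambda>\<epsilon>. quad_term (\<lambda>i j. \<sigma> i j \<epsilon>) a);
                 g = (\<lambda>\<epsilon>. quad_term (\<lambda>i j. \<tau> i j \<epsilon>) b)
             in (\<forall>\<epsilon>>0. smooth_hopf \<omega> (f \<epsilon>) (g \<epsilon>) \<and> opposite_criticality \<omega> a b (f \<epsilon>) (g \<epsilon>)) \<and>
                (\<forall>K. compact K \<longrightarrow>
                   Linf_tendsto K (\<lambda>\<epsilon> p. (f \<epsilon> p, g \<epsilon> p)) (\<lambda>p. (abs_term a p, abs_term b p)))))"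
proof -
  obtain \<alpha> \<beta> :: "2 \<Rightarrow> 2 \<Rightarrow> real" where pos: "\<And>i j. \<alpha> i j > 0" "\<And>i j. \<beta> i j > 0"
    and opposing: "sigma_sharp a b *
      (3 * a $ 1 $ 1 * \<alpha> 1 1 + a $ 1 $ 2 * \<alpha> 1 2 + b $ 2 $ 1 * \<beta> 2 1 + 3 * b $ 2 $ 2 * \<beta> 2 2) < 0
      \<or> sigma_sharp a b = 0"
    using opposing_weights[OF assms(2)] by metis
  \<comment> \<open>The same weights serve every positive smooth profile with value 1 at 0. Both
    halves of the theorem are instances of this fact and differ only in the profile.\<close>
  have hopf: "smooth_hopf \<omega> (soft_term \<rho> \<alpha> a \<epsilon>) (soft_term \<rho> \<beta> b \<epsilon>) \<and>
      opposite_criticality \<omega> a b (soft_term \<rho> \<alpha> a \<epsilon>) (soft_term \<rho> \<beta> b \<epsilon>)"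
    if "\<epsilon> > 0" "smooth \<rho>" "\<And>x. \<rho> x > 0" "\<rho> 0 = 1" for \<rho> \<epsilon>
    using soft_term_hopf[OF assms(1) that(1) pos that(2-4)] opposing that(1)
    by (auto simp: opposite_criticality_def nonsmooth_subcritical_def nonsmooth_supercritical_def
        smooth_subcritical_def smooth_supercritical_def mult_less_0_iff
        divide_less_0_iff zero_less_divide_iff)
  \<comment> \<open>The value 1 at 0 preserves the first Lyapunov coefficient, while the decay
    bounds \<open>\<bar>x\<bar> * \<rho> x\<close> by 1 on the whole line.\<close>
  define \<rho> :: "real \<Rightarrow> real" where "\<rho> x = 1 / sqrt (1 + x\<^sup>2)" for x
  have \<rho>: "smooth \<rho>" "\<And>x. \<rho> x > 0" "\<rho> 0 = 1"
    unfolding \<rho>_def by (auto intro!: smooth_intros add_pos_nonneg)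
  have \<rho>_bound: "\<bar>x\<bar> * \<rho> x \<le> 1" for x
    by (auto simp: \<rho>_def divide_simps add_pos_nonneg intro!: real_le_rsqrt)
  show ?thesis (is "?A \<and> ?B")
  proof
    show ?A
      using hopf[OF _ \<rho>] \<rho>_bound
      by (intro exI[of _ "soft_term \<rho> \<alpha> a"] exI[of _ "soft_term \<rho> \<beta> b"] conjI
          Linf_tendsto_soft_term[where B = 1] pos \<rho>) auto
    \<comment> \<open>For the constant profile the error bound grows with the coordinates; on a
      compact set a bound on the norm controls it.\<close>
    have "Linf_tendsto K (\<lambda>\<epsilon> p. (soft_term (\<lambda>_. 1) \<alpha> a \<epsilon> p, soft_term (\<lambda>_. 1) \<beta> b \<epsilon> p))
        (\<lambda>p. (abs_term a p, abs_term b p))" if K: "compact K" for K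
    proof -
      obtain B where B: "\<And>p. p \<in> K \<Longrightarrow> norm p \<le> B"
        using compact_imp_bounded[OF K] by (auto simp: bounded_iff)
      show ?thesis
      proof (rule Linf_tendsto_soft_term[where B = B])
        show "\<bar>v\<bar> * 1 \<le> B \<and> \<bar>w\<bar> * 1 \<le> B" if "(v, w) \<in> K" for v w
          using B[OF that] norm_fst_le[of v w] norm_snd_le[of w v] by auto
      qed (auto simp: pos smooth_const)
    qed
    then show ?B
      using hopf[of _ "\<lambda>_. 1"] pos
      by (intro exI[of _ "\<lambda>i j \<epsilon>. soft_abs (\<epsilon> / \<alpha> i j)"] exI[of _ "\<lambda>i j \<epsilon>. soft_abs (\<epsilon> / \<beta> i j)"])
         (auto simp: Let_def soft_term_one smooth_convex_abs_approx_soft_abs smooth_const)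
  qed
qed

end
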